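(* Let $\beta>1$ be a cubic Pisot unit with minimal polynomial $x^3-ax^2+bx-c$ (where $a,b,c\in\mathbb{Z}$). Then $\beta$ has Property ($-$F) if and only if $c=1$ and $-1\le b<a$, $|a|+|b| \ge 2$.
   Context: A Pisot number is an algebraic integer $\beta>1$ all of whose other Galois conjugates have absolute value less than $1$; a cubic Pisot unit is a Pisot number of degree $3$ that is an algebraic unit (i.e. $c=\pm1$). For a real number $\beta>1$, set $\ell_\beta = \frac{-\beta}{\beta+1}$ and define the $(-\beta)$-transformation $T_{-\beta}: [\ell_\beta,\ell_\beta+1)\to[\ell_\beta,\ell_\beta+1)$ by $T_{-\beta}(x) = -\beta x - \lfloor -\beta x-\ell_\beta\rfloor$. For $x\in[\ell_\beta,\ell_\beta+1)$ let $d_{-\beta}(x)=x_1x_2x_3\cdots$ with $x_i = \lfloor -\beta T_{-\beta}^{i-1}(x)-\ell_\beta\rfloor\in\{0,1,\dots,\lfloor\beta\rfloor\}$, so that $x=\sum_{i\ge1} x_i(-\beta)^{-i}$. For $x\in\mathbb{R}$, let $k\ge 0$ be the minimal integer with $\frac{x}{(-\beta)^k}\in(\ell_\beta,\ell_\beta+1)$ and let $d_{-\beta}(\frac{x}{(-\beta)^k})=x_1x_2x_3\cdots$; the $(-\beta)$-expansion of $x$ is $x_1\cdots x_k\bullet x_{k+1}x_{k+2}\cdots$ if $k\ge1$ and $0\bullet x_1x_2\cdots$ if $k=0$. It is finite if only finitely many digits are nonzero, i.e. if $T_{-\beta}^n(\frac{x}{(-\beta)^k})=0$ for some $n\ge0$.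 The number $\beta$ has Property ($-$F) if each element of $\mathbb{Z}[\beta^{-1}]$ has a finite $(-\beta)$-expansion. *)

theory Defs
  imports Complex_Main "HOL-Computational_Algebra.Polynomial"
begin

definition is_min_poly :: "'a :: field_char_0 \<Rightarrow> rat poly \<Rightarrow> bool" where
  "is_min_poly x p \<longleftrightarrow>
     lead_coeff p = 1 \<and> poly (map_poly of_rat p) x = 0 \<and>
     (\<forall>q. lead_coeff q = 1 \<and> poly (map_poly of_rat q) x = 0 \<longrightarrow> degree p \<le> degree q)"

definition galois_conjugates :: "real \<Rightarrow> complex set" where
  "galois_conjugates x = {z. \<exists>p. is_min_poly x p \<and> poly (map_poly of_rat p) z = 0}"

definition pisot_number :: "real \<Rightarrow> bool" where
  "pisot_number \<beta> \<longleftrightarrow>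
     algebraic_int \<beta> \<and> \<beta> > 1 \<and>
     (\<forall>z \<in> galois_conjugates \<beta> - {complex_of_real \<beta>}. norm z < 1)"

definition algebraic_unit :: "'a :: field_char_0 \<Rightarrow> bool" where
  "algebraic_unit x \<longleftrightarrow> x \<noteq> 0 \<and> algebraic_int x \<and> algebraic_int (inverse x)"

definition cubic_pisot_unit :: "real \<Rightarrow> bool" where
  "cubic_pisot_unit \<beta> \<longleftrightarrow>
     pisot_number \<beta> \<and> (\<exists>p. is_min_poly \<beta> p \<and> degree p = 3) \<and> algebraic_unit \<beta>"

definition ell :: "real \<Rightarrow> real" where
  "ell \<beta> = - \<beta> / (\<beta> + 1)"

(* T_{-\<beta>} as a total function; it is only meaningful on {ell \<beta>..<ell \<beta> + 1}. *)
definition neg_beta_map :: "real \<Rightarrow> real \<Rightarrow> real" where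
  "neg_beta_map \<beta> x = - \<beta> * x - of_int \<lfloor>- \<beta> * x - ell \<beta>\<rfloor>"

(* Indices are shifted by one: neg_beta_digit \<beta> x i is the digit x_{i+1}, i.e. the
   coefficient of (-\<beta>)^(-(i+1)). *)
definition neg_beta_digit :: "real \<Rightarrow> real \<Rightarrow> nat \<Rightarrow> int" where
  "neg_beta_digit \<beta> x i = \<lfloor>- \<beta> * (neg_beta_map \<beta> ^^ i) x - ell \<beta>\<rfloor>"

(* For \<beta> > 1 such a k always exists, since 0 lies in the open interval. *)
definition neg_beta_shift :: "real \<Rightarrow> real \<Rightarrow> nat" where
  "neg_beta_shift \<beta> x = (LEAST k. x / (- \<beta>) ^ k \<in> {ell \<beta> <..< ell \<beta> + 1})"

(* The digits before and after the radix point. *)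
definition neg_beta_expansion :: "real \<Rightarrow> real \<Rightarrow> int list \<times> (nat \<Rightarrow> int)" where
  "neg_beta_expansion \<beta> x =
     (let k = neg_beta_shift \<beta> x;
          d = neg_beta_digit \<beta> (x / (- \<beta>) ^ k)
      in (if k = 0 then [0] else map d [0..<k], \<lambda>i. d (k + i)))"

definition finite_neg_beta_expansion :: "real \<Rightarrow> real \<Rightarrow> bool" where
  "finite_neg_beta_expansion \<beta> x \<longleftrightarrow> finite {i. snd (neg_beta_expansion \<beta> x) i \<noteq> 0}"

(* The ring Z[x]. *)
definition int_adjoin :: "'a :: comm_ring_1 \<Rightarrow> 'a set" where
  "int_adjoin x = range (\<lambda>p :: int poly. poly (map_poly of_int p) x)"

definition property_neg_F :: "real \<Rightarrow> bool" where
  "property_neg_F \<beta> \<longleftrightarrow> (\<forall>x \<in> int_adjoin (inverse \<beta>). finite_neg_beta_expansion \<beta> x)"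

end

theory Submission
  imports Defs "HOL-Library.Product_Plus"
begin

text \<open>Sufficiency: in the basis given by the cofactor of \<open>x + \<beta>\<close>, the map \<open>T\<close> on
  \<open>\<int>[1/\<beta>]\<close> becomes a shift radix system on \<open>\<int> \<times> \<int>\<close>. By Brunotte's argument all its orbits reach
  \<open>0\<close> as soon as this holds on a finite set of witnesses, and subsets of \<open>{-1, 0, 1}\<^sup>2\<close> depending only
  on whether \<open>b\<close> is \<open>-1\<close>, \<open>0\<close>, \<open>1\<close> or larger are enough.

  Necessity: \<open>c = -1\<close> forces a negative conjugate, under which finite expansions have a constant sign.
  For \<open>c = 1\<close> the Pisot property gives \<open>b < a\<close> and \<open>a + b \<ge> -1\<close>; if \<open>b \<le> -2\<close> or \<open>a + b = -1\<close>, then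
  \<open>-(a + b + 2)/(\<beta> + 1)\<close> is a nonzero fixed point of \<open>T\<close> in \<open>\<int>[1/\<beta>]\<close>, and for \<open>(a, b) = (1, 0)\<close> the
  point \<open>1 - 1/\<beta>\<close> has period 5.\<close>

section \<open>The transformation and finite expansions\<close>

lemma ell_add_one: "\<beta> > 1 \<Longrightarrow> ell \<beta> + 1 = 1 / (\<beta> + 1)"
  by (simp add: ell_def field_simps)

lemma ell_bounds: "\<beta> > 1 \<Longrightarrow> - 1 < ell \<beta> \<and> ell \<beta> < 0 \<and> 0 < ell \<beta> + 1"
  by (simp add: ell_def field_simps)

lemma neg_beta_map_range:
  "ell \<beta> \<le> neg_beta_map \<beta> x" "neg_beta_map \<beta> x < ell \<beta> + 1"
  unfolding neg_beta_map_def by linarith+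

text \<open>Since \<open>y\<close> lies in the half-open unit interval, \<open>d\<close> must be the
  floor; images are thus computed by exhibiting a point of the interval congruent to
  \<open>- \<beta> * x\<close> modulo 1.\<close>

lemma neg_beta_map_eqI:
  assumes "- \<beta> * x - y = of_int d" "ell \<beta> \<le> y" "y < ell \<beta> + 1"
  shows "neg_beta_map \<beta> x = y"
proof -
  have "\<lfloor>- \<beta> * x - ell \<beta>\<rfloor> = d"
    using assms by (intro floor_unique) linarith+
  then show ?thesis
    using assms by (simp add: neg_beta_map_def)
qed

lemma neg_beta_map_0: "\<beta> > 1 \<Longrightarrow> neg_beta_map \<beta> 0 = 0"
  using ell_bounds[of \<beta>] by (intro neg_beta_map_eqI[where d = 0]) auto

lemma funpow_fixed_ge:
  assumes "(f ^^ n) x = y" "f y = y" "n \<le> m"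
  shows "(f ^^ m) x = y"
  using assms(3)
proof (induction m rule: dec_induct)
  case base
  then show ?case using assms(1) by simp
next
  case (step k)
  then show ?case using assms(2) by simp
qed

lemma neg_beta_map_digit:
  "(neg_beta_map \<beta> ^^ Suc i) x = - \<beta> * (neg_beta_map \<beta> ^^ i) x - of_int (neg_beta_digit \<beta> x i)"
  by (simp add: neg_beta_digit_def neg_beta_map_def)

lemma neg_beta_shift:
  assumes "\<beta> > 1"
  shows "x / (- \<beta>) ^ neg_beta_shift \<beta> x \<in> {ell \<beta> <..< ell \<beta> + 1}"
proof -
  have "(\<lambda>k. x * (1 / (- \<beta>)) ^ k) \<longlonglongrightarrow> x * 0"
    using assms by (intro tendsto_mult tendsto_const LIMSEQ_power_zero) auto
  then have "\<forall>\<^sub>F k in sequentially. x * (1 / (- \<beta>)) ^ k \<in> {ell \<beta> <..< ell \<beta> + 1}"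
    using ell_bounds[OF assms] by (intro topological_tendstoD) auto
  then obtain k where "x * (1 / (- \<beta>)) ^ k \<in> {ell \<beta> <..< ell \<beta> + 1}"
    by (auto simp: eventually_sequentially)
  then have "x / (- \<beta>) ^ k \<in> {ell \<beta> <..< ell \<beta> + 1}"
    by (simp only: power_one_over times_divide_eq_right mult_1_right)
  then show ?thesis
    unfolding neg_beta_shift_def by (rule LeastI)
qed

lemma neg_beta_shift_eq_0:
  "x \<in> {ell \<beta> <..< ell \<beta> + 1} \<Longrightarrow> neg_beta_shift \<beta> x = 0"
  unfolding neg_beta_shift_def by (rule Least_equality) auto

text \<open>A zero digit means plain multiplication by \<open>- \<beta>\<close>, so a nonzero point
  followed only by zero digits would have an unbounded orbit. The exponent is \<open>Suc N\<close>
  because \<open>y\<close> is arbitrary: only after a step is the point known to lie in the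
  interval.\<close>

lemma eventually_zero_digits_imp_zero:
  assumes "\<beta> > 1" and zero: "\<And>i. i \<ge> N \<Longrightarrow> neg_beta_digit \<beta> y i = 0"
  shows "(neg_beta_map \<beta> ^^ Suc N) y = 0"
proof (rule ccontr)
  let ?z = "(neg_beta_map \<beta> ^^ Suc N) y"
  assume "?z \<noteq> 0"
  have pow: "(neg_beta_map \<beta> ^^ (Suc N + j)) y = (- \<beta>) ^ j * ?z" for j
  proof (induction j)
    case (Suc j)
    have "(neg_beta_map \<beta> ^^ (Suc N + Suc j)) y = - \<beta> * (neg_beta_map \<beta> ^^ (Suc N + j)) y"
      using neg_beta_map_digit[where \<beta> = \<beta> and i = "Suc N + j" and x = y] zero[of "Suc N + j"] by simp
    then show ?case using Suc by simp
  qed simp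
  have "\<bar>(neg_beta_map \<beta> ^^ (Suc N + j)) y\<bar> < 1" for j
    using neg_beta_map_range[of \<beta> "(neg_beta_map \<beta> ^^ (N + j)) y"] ell_bounds[OF assms(1)]
    by (simp only: funpow.simps comp_apply add_Suc) linarith
  then have "\<beta> ^ j * \<bar>?z\<bar> < 1" for j
    using assms(1) unfolding pow by (simp add: abs_mult power_abs)
  moreover obtain j where "1 / \<bar>?z\<bar> < \<beta> ^ j"
    using real_arch_pow[OF assms(1)] by blast
  ultimately show False
    using \<open>?z \<noteq> 0\<close> by (smt (verit) divide_less_eq zero_less_abs_iff)
qed

lemma finite_neg_beta_expansion_iff:
  assumes "\<beta> > 1"
  shows "finite_neg_beta_expansion \<beta> x \<longleftrightarrow>
    (\<exists>n. (neg_beta_map \<beta> ^^ n) (x / (- \<beta>) ^ neg_beta_shift \<beta> x) = 0)"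
proof -
  define k where "k = neg_beta_shift \<beta> x"
  define y where "y = x / (- \<beta>) ^ k"
  have snd: "snd (neg_beta_expansion \<beta> x) = (\<lambda>i. neg_beta_digit \<beta> y (k + i))"
    by (simp add: neg_beta_expansion_def Let_def k_def y_def)
  have "finite {i. neg_beta_digit \<beta> y (k + i) \<noteq> 0} \<longleftrightarrow> (\<exists>n. (neg_beta_map \<beta> ^^ n) y = 0)"
  proof
    assume "finite {i. neg_beta_digit \<beta> y (k + i) \<noteq> 0}"
    then obtain M where M: "\<And>i. neg_beta_digit \<beta> y (k + i) \<noteq> 0 \<Longrightarrow> i < M"
      unfolding finite_nat_set_iff_bounded by blast
    have "neg_beta_digit \<beta> y i = 0" if "i \<ge> k + M" for i
      using M[of "i - k"] that by fastforce
    then show "\<exists>n. (neg_beta_map \<beta> ^^ n) y = 0"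
      using eventually_zero_digits_imp_zero[OF assms] by blast
  next
    assume "\<exists>n. (neg_beta_map \<beta> ^^ n) y = 0"
    then obtain n where n: "(neg_beta_map \<beta> ^^ n) y = 0" by blast
    have zero: "(neg_beta_map \<beta> ^^ i) y = 0" if "i \<ge> n" for i
      using funpow_fixed_ge[OF n neg_beta_map_0[OF assms] that] .
    have "neg_beta_digit \<beta> y i = 0" if "i \<ge> n" for i
      using neg_beta_map_digit[where \<beta> = \<beta> and i = i and x = y] zero[of i] zero[of "Suc i"] that
      by (simp del: funpow.simps)
    then have "{i. neg_beta_digit \<beta> y (k + i) \<noteq> 0} \<subseteq> {..<n}"
      by (auto simp: not_less[symmetric]) (meson not_less trans_le_add2)
    then show "finite {i. neg_beta_digit \<beta> y (k + i) \<noteq> 0}"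
      using finite_subset by blast
  qed
  then show ?thesis
    by (simp add: finite_neg_beta_expansion_def snd y_def k_def)
qed

lemma not_property_neg_F_if_periodic:
  assumes "\<beta> > 1" "x \<in> int_adjoin (inverse \<beta>)" "x \<in> {ell \<beta> <..< ell \<beta> + 1}"
    and "x \<noteq> 0" "p > 0" and per: "(neg_beta_map \<beta> ^^ p) x = x"
  shows "\<not> property_neg_F \<beta>"
proof
  assume "property_neg_F \<beta>"
  then obtain n where n: "(neg_beta_map \<beta> ^^ n) x = 0"
    using assms(1-3) by (auto simp: property_neg_F_def finite_neg_beta_expansion_iff neg_beta_shift_eq_0)
  \<comment> \<open>\<open>p * n\<close> is a multiple of the period and at least
    \<open>n\<close>.\<close>
  have "(neg_beta_map \<beta> ^^ (p * n)) x = 0"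
    using funpow_fixed_ge[OF n neg_beta_map_0[OF assms(1)], of "p * n"] assms(5) by simp
  moreover have "(neg_beta_map \<beta> ^^ (p * m)) x = x" for m
    by (induction m) (simp_all add: funpow_add per)
  ultimately show False
    using assms(4) by metis
qed

section \<open>Shift radix systems\<close>

text \<open>The shift \<open>\<delta>\<close> moves the remainder interval: the new entry
  \<open>k\<close> is the unique integer with \<open>m * r + n * s + k\<close> in
  \<open>[- \<delta>, 1 - \<delta>)\<close>.\<close>

definition srs :: "real \<Rightarrow> real \<Rightarrow> real \<Rightarrow> int \<times> int \<Rightarrow> int \<times> int" where
  "srs r s \<delta> = (\<lambda>(m, n). (n, - \<lfloor>of_int m * r + of_int n * s + \<delta>\<rfloor>))"

definition srs_finite :: "real \<Rightarrow> real \<Rightarrow> real \<Rightarrow> int \<times> int \<Rightarrow> bool" where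
  "srs_finite r s \<delta> z \<longleftrightarrow> (\<exists>i. (srs r s \<delta> ^^ i) z = (0, 0))"

lemma srs_finite_0: "srs_finite r s \<delta> (0, 0)"
  unfolding srs_finite_def by (rule exI[of _ 0]) simp

lemma srs_finite_step:
  assumes "srs_finite r s \<delta> (n, k)"
    and "- \<delta> \<le> of_int m * r + of_int n * s + of_int k"
    and "of_int m * r + of_int n * s + of_int k < 1 - \<delta>"
  shows "srs_finite r s \<delta> (m, n)"
proof -
  have "\<lfloor>of_int m * r + of_int n * s + \<delta>\<rfloor> = - k"
    using assms(2,3) by (intro floor_unique) auto
  then have "srs r s \<delta> (m, n) = (n, k)"
    by (simp add: srs_def)
  moreover obtain i where "(srs r s \<delta> ^^ i) (n, k) = (0, 0)"
    using assms(1) unfolding srs_finite_def by blast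
  ultimately have "(srs r s \<delta> ^^ Suc i) (m, n) = (0, 0)"
    by (simp add: funpow_swap1)
  then show ?thesis unfolding srs_finite_def by blast
qed

text \<open>The closure condition is free of \<open>\<delta>\<close>: a summand in
  \<open>[k, k + 1]\<close> raises any floor by \<open>k\<close> or \<open>k + 1\<close>, and both
  outcomes must stay in \<open>V\<close>. The unit vectors make sums of witnesses exhaust the
  lattice.\<close>

definition srs_witness :: "real \<Rightarrow> real \<Rightarrow> (int \<times> int) set \<Rightarrow> bool" where
  "srs_witness r s V \<longleftrightarrow> {(0, 0), (1, 0), (-1, 0), (0, 1), (0, -1)} \<subseteq> V \<and>
     (\<forall>(m, n) \<in> V. (m, n) = (0, 0) \<or>
       (\<exists>k. of_int k \<le> of_int m * r + of_int n * s \<and> of_int m * r + of_int n * s \<le> of_int k + 1 \<and>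
          (n, - k) \<in> V \<and> (n, - k - 1) \<in> V))"

text \<open>Since \<open>\<lfloor>A + B\<rfloor> - \<lfloor>A\<rfloor>\<close> only depends on \<open>B\<close> up to rounding, adding an element of a witness set
  before a step amounts to adding an element of the witness set after the step (Brunotte).\<close>

lemma srs_witness_add:
  assumes V: "srs_witness r s V" and v: "(m', n') \<in> V"
  shows "\<exists>w \<in> V. srs r s \<delta> (m + m', n + n') = srs r s \<delta> (m, n) + w"
proof (cases "(m', n') = (0, 0)")
  case True
  then show ?thesis
    using v by (intro bexI[of _ "(0, 0)"]) (auto simp: srs_def)
next
  case False
  then obtain k where k: "of_int k \<le> of_int m' * r + of_int n' * s"
      "of_int m' * r + of_int n' * s \<le> of_int k + 1" "(n', - k) \<in> V" "(n', - k - 1) \<in> V"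
    using V v unfolding srs_witness_def by fast
  let ?A = "of_int m * r + of_int n * s + \<delta>" and ?B = "of_int m' * r + of_int n' * s"
  have step: "srs r s \<delta> (m + m', n + n') = (n + n', - \<lfloor>?A + ?B\<rfloor>)"
    by (simp add: srs_def algebra_simps)
  have "\<lfloor>?A + ?B\<rfloor> = \<lfloor>?A\<rfloor> + k \<or> \<lfloor>?A + ?B\<rfloor> = \<lfloor>?A\<rfloor> + k + 1"
    using k(1,2) by linarith
  then have "srs r s \<delta> (m + m', n + n') = srs r s \<delta> (m, n) + (n', - k) \<or>
      srs r s \<delta> (m + m', n + n') = srs r s \<delta> (m, n) + (n', - k - 1)"
    unfolding step by (auto simp: srs_def)
  then show ?thesis using k(3,4) by blast
qed

text \<open>The perturbed orbit differs from that of \<open>z\<close> by a witness at every step.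
  Once the latter is at the origin, the former is at a witness, and \<open>fin\<close> takes
  over.\<close>

lemma srs_finite_add:
  assumes V: "srs_witness r s V" and fin: "\<And>v. v \<in> V \<Longrightarrow> srs_finite r s \<delta> v"
    and z: "srs_finite r s \<delta> z" and v: "v \<in> V"
  shows "srs_finite r s \<delta> (z + v)"
proof -
  obtain i where "(srs r s \<delta> ^^ i) z = (0, 0)"
    using z unfolding srs_finite_def by blast
  then show ?thesis using v
  proof (induction i arbitrary: z v)
    case 0
    then show ?case using fin[of v] by (simp add: zero_prod_def[symmetric])
  next
    case (Suc i)
    obtain m n m' n' where [simp]: "z = (m, n)" "v = (m', n')"
      by (metis surj_pair)
    obtain w where w: "w \<in> V" "srs r s \<delta> (z + v) = srs r s \<delta> z + w"
      using srs_witness_add[OF V, of m' n' \<delta> m n] Suc.prems(2) by auto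
    have "srs_finite r s \<delta> (srs r s \<delta> z + w)"
      using Suc.prems(1) w(1) by (intro Suc.IH) (simp_all add: funpow_swap1)
    then obtain j where "(srs r s \<delta> ^^ j) (srs r s \<delta> (z + v)) = (0, 0)"
      using w(2) unfolding srs_finite_def by metis
    then have "(srs r s \<delta> ^^ Suc j) (z + v) = (0, 0)"
      by (simp add: funpow_swap1)
    then show ?case unfolding srs_finite_def by blast
  qed
qed

lemma srs_finite_all:
  assumes V: "srs_witness r s V" and fin: "\<And>v. v \<in> V \<Longrightarrow> srs_finite r s \<delta> v"
  shows "srs_finite r s \<delta> z"
proof -
  have e: "(1, 0) \<in> V" "(-1, 0) \<in> V" "(0, 1) \<in> V" "(0, -1) \<in> V"
    using V unfolding srs_witness_def by blast+
  note add = srs_finite_add[OF V fin]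
  obtain m n where z: "z = (m, n)" by (metis surj_pair)
  have "srs_finite r s \<delta> (m, 0)"
  proof (induction m rule: int_induct[where k = 0])
    case base
    then show ?case by (rule srs_finite_0)
  next
    case (step1 i)
    then show ?case using add[OF _ _ e(1), of "(i, 0)"] by simp
  next
    case (step2 i)
    then show ?case using add[OF _ _ e(2), of "(i, 0)"] by simp
  qed
  then show ?thesis unfolding z
  proof (induction n rule: int_induct[where k = 0])
    case base
    then show ?case by simp
  next
    case (step1 i)
    then show ?case using add[OF _ _ e(3), of "(m, i)"] by simp
  next
    case (step2 i)
    then show ?case using add[OF _ _ e(4), of "(m, i)"] by simp
  qed
qed

section \<open>Witness sets with entries in -1, 0, 1 for four ranges of \<open>s\<close>\<close>

lemma srs_witnessI:
  assumes "{(0, 0), (1, 0), (-1, 0), (0, 1), (0, -1)} \<subseteq> V"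
    and "\<And>m n. (m, n) \<in> V \<Longrightarrow> (m, n) \<noteq> (0, 0) \<Longrightarrow>
      0 \<le> of_int m * r + of_int n * s \<and> of_int m * r + of_int n * s \<le> 1 \<and> (n, 0) \<in> V \<and> (n, -1) \<in> V \<or>
      -1 \<le> of_int m * r + of_int n * s \<and> of_int m * r + of_int n * s \<le> 0 \<and> (n, 1) \<in> V \<and> (n, 0) \<in> V"
  shows "srs_witness r s V"
proof -
  have "\<exists>k. of_int k \<le> of_int m * r + of_int n * s \<and> of_int m * r + of_int n * s \<le> of_int k + 1 \<and>
          (n, - k) \<in> V \<and> (n, - k - 1) \<in> V" if "(m, n) \<in> V" "(m, n) \<noteq> (0, 0)" for m n
    using assms(2)[OF that]
  proof (elim disjE, goal_cases)
    case 1
    then show ?case by (intro exI[of _ 0]) auto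
  next
    case 2
    then show ?case by (intro exI[of _ "-1"]) auto
  qed
  then show ?thesis using assms(1) unfolding srs_witness_def by blast
qed

text \<open>Meant for \<open>b \<ge> 2\<close>, with \<open>u = 1 / \<beta>\<close> and
  \<open>s = b * u - u\<^sup>2\<close>. Here \<open>u + s\<close> may exceed 1, so
  \<open>(1, 1)\<close> is kept out of the witness set; because \<open>u \<le> s\<close>, the
  closure condition at \<open>(1, -1)\<close> only asks for \<open>(-1, 0)\<close> and
  \<open>(-1, 1)\<close>.\<close>

lemma srs_finite_pos_coeff:
  assumes "0 < u" "u \<le> s" "s < 1" "u\<^sup>2 + u < 1" "s * (1 + u) \<le> 1 \<or> u\<^sup>2 + 2 * u \<le> 1"
  shows "srs_finite u s (1 / (1 + u)) z"
proof -
  \<comment> \<open>\<open>D\<close> is \<open>- ell \<beta>\<close> for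
    \<open>\<beta> = 1 / u\<close>; multiplied by \<open>1 + u\<close>, the bound
    \<open>u \<le> D\<close> reads \<open>u + u\<^sup>2 \<le> 1\<close>.\<close>
  define D where "D = 1 / (1 + u)"
  have D: "u \<le> D" "1 - D \<le> u" "1 - u \<le> D" "D < 1" "D > 0"
    using assms(1,4) by (simp_all add: D_def field_simps power2_eq_square)
  have D': "s \<le> D \<or> 1 - D \<le> D - u"
    using assms(5)
  proof
    assume "s * (1 + u) \<le> 1"
    then show ?thesis using assms(1) by (simp add: D_def field_simps)
  next
    assume "u\<^sup>2 + 2 * u \<le> 1"
    then have "1 + u \<le> 2 * D" using assms(1) by (simp add: D_def field_simps power2_eq_square)
    then show ?thesis by simp
  qed
  \<comment> \<open>Each use of \<open>step\<close> follows one orbit edge from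
    \<open>(m, n)\<close> to \<open>(n, k)\<close>; the witnesses are ordered so that the target is
    already settled.\<close>
  note step = srs_finite_step[where r = u and s = s and \<delta> = D]
  have 1: "srs_finite u s D (-1, 0)"
    by (rule step[where k = 0, OF srs_finite_0]) (use assms D in auto)
  have 2: "srs_finite u s D (1, -1)"
    by (rule step[where k = 0, OF 1]) (use assms D in auto)
  have 3: "srs_finite u s D (0, 1)"
    by (rule step[where k = "-1", OF 2]) (use assms D in auto)
  have 4: "srs_finite u s D (0, -1) \<and> srs_finite u s D (1, 0) \<and> srs_finite u s D (-1, 1)"
  \<comment> \<open>The orbit of \<open>(0, -1)\<close> branches: the next entry is 0 if
    \<open>s \<le> D\<close> and 1 otherwise. In the second case \<open>(-1, 1)\<close> has to be
    settled first, and \<open>D'\<close> sends it to \<open>(1, -1)\<close>.\<close>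
  proof (cases "s \<le> D")
    case True
    have a: "srs_finite u s D (0, -1)"
      by (rule step[where k = 0]) (use 1 assms D True in auto)
    have b: "srs_finite u s D (1, 0)"
      by (rule step[where k = "-1", OF a]) (use assms D in auto)
    have "srs_finite u s D (-1, 1)"
    proof (cases "s - u < 1 - D")
      case True
      show ?thesis by (rule step[where k = 0, OF b]) (use assms D True in auto)
    next
      case False
      show ?thesis by (rule step[where k = "-1", OF 2]) (use assms D False in auto)
    qed
    then show ?thesis using a b by blast
  next
    case False
    have c: "srs_finite u s D (-1, 1)"
      by (rule step[where k = "-1", OF 2]) (use assms D D' False in auto)
    have a: "srs_finite u s D (0, -1)"
      by (rule step[where k = 1, OF c]) (use assms D False in auto)
    have b: "srs_finite u s D (1, 0)"
      by (rule step[where k = "-1", OF a]) (use assms D in auto)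
    show ?thesis using a b c by blast
  qed
  let ?V = "{(0, 0), (1, 0), (-1, 0), (0, 1), (0, -1), (1, -1), (-1, 1)} :: (int \<times> int) set"
  have "srs_witness u s ?V"
    by (rule srs_witnessI) (use assms D in auto)
  moreover have "srs_finite u s D v" if "v \<in> ?V" for v
    using that 1 2 3 4 srs_finite_0 by blast
  ultimately show ?thesis
    unfolding D_def[symmetric] by (rule srs_finite_all)
qed

text \<open>Meant for \<open>b = 1\<close>. Now \<open>u - s = u\<^sup>2\<close> is positive, so
  closure at \<open>(1, -1)\<close> forces \<open>(-1, -1)\<close> into the witness set; this is
  harmless because \<open>u + s \<le> 1\<close>.\<close>

lemma srs_finite_one_coeff:
  assumes "0 < u" "s = u - u\<^sup>2" "u\<^sup>2 + u < 1"
  shows "srs_finite u s (1 / (1 + u)) z"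
proof -
  define D where "D = 1 / (1 + u)"
  have D: "u \<le> D" "1 - D \<le> u" "1 - u \<le> D" "D < 1" "D > 0"
    using assms(1,3) by (simp_all add: D_def field_simps power2_eq_square)
  have u: "u < 1" using assms(1,3) by (smt (verit) zero_le_power2)
  have "u * u < u" using u assms(1) by simp
  then have s: "0 < s" using assms(2) by (simp add: power2_eq_square)
  have "s * (1 + u) < u"
    using assms(1) by (simp add: assms(2) algebra_simps power2_eq_square)
  then have sD: "s < 1 - D"
    using assms(1) by (simp add: D_def field_simps)
  have "0 \<le> (1 - u)\<^sup>2" by simp
  then have us: "u + s \<le> 1"
    by (simp add: assms(2) power2_eq_square algebra_simps)
  \<comment> \<open>The left side is \<open>(u - s) * (1 + u)\<close>, while
    \<open>(1 - D) * (1 + u) = u\<close>.\<close>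
  have "u * (u\<^sup>2 + u) < u * 1" using assms(1,3) by (rule mult_strict_left_mono[rotated])
  then have "(u - s) * (1 + u) < u"
    by (simp add: assms(2) algebra_simps power2_eq_square)
  then have usD: "u - s < 1 - D" "0 \<le> u - s"
    using assms(1) by (simp_all add: D_def field_simps assms(2))
  note step = srs_finite_step[where r = u and s = s and \<delta> = D]
  have 1: "srs_finite u s D (-1, 0)"
    by (rule step[where k = 0, OF srs_finite_0]) (use assms(1) s D in auto)
  have 2: "srs_finite u s D (0, -1)"
    by (rule step[where k = 0, OF 1]) (use u s sD usD assms(1) D in auto)
  have 3: "srs_finite u s D (1, 0)"
    by (rule step[where k = "-1", OF 2]) (use u s assms(1) D in auto)
  have 4: "srs_finite u s D (0, 1)"
    by (rule step[where k = 0, OF 3]) (use u s sD D in auto)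
  have 5: "srs_finite u s D (1, -1)"
    by (rule step[where k = 0, OF 1]) (use u s usD D in auto)
  have 6: "srs_finite u s D (-1, 1)"
    by (rule step[where k = 0, OF 3]) (use u s usD D in auto)
  have 7: "srs_finite u s D (1, 1)"
    by (rule step[where k = "-1", OF 5]) (use u s us D in auto)
  have 8: "srs_finite u s D (-1, -1)"
  proof (cases "u + s \<le> D")
    case True
    show ?thesis by (rule step[where k = 0, OF 1]) (use u s True D assms(1) in auto)
  next
    case False
    show ?thesis by (rule step[where k = 1, OF 6]) (use u s False us D in auto)
  qed
  let ?V = "{(0, 0), (1, 0), (-1, 0), (0, 1), (0, -1), (1, -1), (-1, 1), (1, 1), (-1, -1)} :: (int \<times> int) set"
  have "srs_witness u s ?V"
    by (rule srs_witnessI) (use assms(1) u s us usD D in auto)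
  moreover have "srs_finite u s D v" if "v \<in> ?V" for v
    using that 1 2 3 4 5 6 7 8 srs_finite_0 by blast
  ultimately show ?thesis
    unfolding D_def[symmetric] by (rule srs_finite_all)
qed

text \<open>Meant for \<open>b = 0\<close>, where \<open>- u < s < 0\<close>: closure leads from
  \<open>(0, 1)\<close> to \<open>(1, 1)\<close> and on to \<open>(1, -1)\<close>, so all nine pairs
  occur. The last hypothesis says \<open>u - s \<le> D\<close>.\<close>

lemma srs_finite_zero_coeff:
  assumes "0 < u" "s = - u\<^sup>2" "u\<^sup>2 + u < 1" "(u + u\<^sup>2) * (1 + u) \<le> 1"
  shows "srs_finite u s (1 / (1 + u)) z"
proof -
  define D where "D = 1 / (1 + u)"
  have D: "u \<le> D" "1 - D \<le> u" "1 - u \<le> D" "D < 1" "D > 0"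
    using assms(1,3) by (simp_all add: D_def field_simps power2_eq_square)
  have u: "u < 1" using assms(1,3) by (smt (verit) zero_le_power2)
  have s: "- 1 < s" "s < 0" "- u < s"
    using u assms(1-3) by (auto simp: power2_eq_square)
  have "u * (u\<^sup>2 + u) < u * 1" using assms(1,3) by (rule mult_strict_left_mono[rotated])
  then have sD: "- s < 1 - D"
    using assms(1) by (simp add: D_def field_simps assms(2) power2_eq_square)
  have usD: "u - s \<le> D"
    using assms(1,4) by (simp add: D_def field_simps assms(2))
  have "(u + s) * (1 + u) < u"
    using assms(1) by (simp add: assms(2) algebra_simps power2_eq_square)
  then have us: "u + s < 1 - D"
    using assms(1) by (simp add: D_def field_simps)
  note step = srs_finite_step[where r = u and s = s and \<delta> = D]
  have 1: "srs_finite u s D (-1, 0)"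
    by (rule step[where k = 0, OF srs_finite_0]) (use assms(1) s D in auto)
  have 2: "srs_finite u s D (0, -1)"
    by (rule step[where k = 0, OF 1]) (use u s sD assms(1) D in auto)
  have 3: "srs_finite u s D (1, 0)"
    by (rule step[where k = "-1", OF 2]) (use u s assms(1) D in auto)
  have 4: "srs_finite u s D (0, 1)"
    by (rule step[where k = 0, OF 3]) (use u s sD usD assms(1) D in auto)
  have 5: "srs_finite u s D (-1, 1)"
    by (rule step[where k = 0, OF 3]) (use u s usD assms(1) D in auto)
  have 6: "srs_finite u s D (1, 1)"
    by (rule step[where k = 0, OF 3]) (use u s us assms(1) D in auto)
  have 7: "srs_finite u s D (-1, -1)"
    by (rule step[where k = 0, OF 1]) (use u s usD assms(1) D in auto)
  have 8: "srs_finite u s D (1, -1)"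
    by (rule step[where k = "-1", OF 7]) (use u s usD D in auto)
  let ?V = "{(0, 0), (1, 0), (-1, 0), (0, 1), (0, -1), (1, -1), (-1, 1), (1, 1), (-1, -1)} :: (int \<times> int) set"
  have "srs_witness u s ?V"
    by (rule srs_witnessI) (use assms(1) u s usD D in auto)
  moreover have "srs_finite u s D v" if "v \<in> ?V" for v
    using that 1 2 3 4 5 6 7 8 srs_finite_0 by blast
  ultimately show ?thesis
    unfolding D_def[symmetric] by (rule srs_finite_all)
qed

text \<open>Meant for \<open>b = -1\<close>. Here \<open>u - s\<close> may exceed 1, so pairs of
  opposite signs must be avoided. They do not arise: \<open>s\<close> and
  \<open>u + s = - u\<^sup>2\<close> are negative, so \<open>(0, 1)\<close> and
  \<open>(1, 1)\<close> lead only to \<open>(1, 0)\<close> and \<open>(1, 1)\<close>.\<close>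

lemma srs_finite_neg_coeff:
  assumes "0 < u" "s = - u - u\<^sup>2" "u\<^sup>2 + u < 1"
  shows "srs_finite u s (1 / (1 + u)) z"
proof -
  define D where "D = 1 / (1 + u)"
  have D: "u \<le> D" "1 - D \<le> u" "1 - u \<le> D" "D < 1" "D > 0"
    using assms(1,3) by (simp_all add: D_def field_simps power2_eq_square)
  have u: "u < 1" using assms(1,3) by (smt (verit) zero_le_power2)
  have s: "- 1 < s" "s < - u" "- 1 < u + s"
    using assms(1-3) by auto
  have "u * (u\<^sup>2 + u) < u * 1" using assms(1,3) by (rule mult_strict_left_mono[rotated])
  then have us: "- (u + s) < 1 - D"
    using assms(1) by (simp add: D_def field_simps assms(2) power2_eq_square)
  note step = srs_finite_step[where r = u and s = s and \<delta> = D]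
  have 1: "srs_finite u s D (-1, 0)"
    by (rule step[where k = 0, OF srs_finite_0]) (use assms(1) s D in auto)
  have 2: "srs_finite u s D (-1, -1)"
    by (rule step[where k = 0, OF 1]) (use u s us assms(1) D in auto)
  have 3: "srs_finite u s D (0, -1)"
    by (rule step[where k = "-1", OF 2]) (use u s assms(1) D in auto)
  have 4: "srs_finite u s D (1, 0)"
    by (rule step[where k = "-1", OF 3]) (use u s assms(1) D in auto)
  have 5: "srs_finite u s D (1, 1)"
    by (rule step[where k = 0, OF 4]) (use u s us assms(1) D in auto)
  have 6: "srs_finite u s D (0, 1)"
  proof (cases "- D \<le> s")
    case True
    show ?thesis by (rule step[where k = 0, OF 4]) (use u s True D assms(1) in auto)
  next
    case False
    show ?thesis by (rule step[where k = 1, OF 5]) (use u s False D in auto)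
  qed
  let ?V = "{(0, 0), (1, 0), (-1, 0), (0, 1), (0, -1), (1, 1), (-1, -1)} :: (int \<times> int) set"
  have "srs_witness u s ?V"
    by (rule srs_witnessI) (use assms(1) u s us D in auto)
  moreover have "srs_finite u s D v" if "v \<in> ?V" for v
    using that 1 2 3 4 5 6 srs_finite_0 by blast
  ultimately show ?thesis
    unfolding D_def[symmetric] by (rule srs_finite_all)
qed

section \<open>Sufficiency\<close>

text \<open>With \<open>s = a - \<beta>\<close>, the polynomial \<open>x\<^sup>2 + (a - \<beta>) x + 1/\<beta>\<close> is the cofactor of \<open>x + \<beta>\<close> in
  \<open>x\<^sup>3 + a x\<^sup>2 + b x + 1\<close>, which is why multiplication by \<open>-\<beta>\<close> acts as a shift on the pairs \<open>(m, n)\<close>.\<close>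

definition srs_value :: "real \<Rightarrow> real \<Rightarrow> real \<Rightarrow> int \<times> int \<Rightarrow> real" where
  "srs_value r s \<delta> = (\<lambda>(m, n). of_int m * r + of_int n * s - of_int \<lfloor>of_int m * r + of_int n * s + \<delta>\<rfloor>)"

lemma inverse_cubic:
  fixes \<beta> a b :: real
  assumes "\<beta> > 0" "\<beta> ^ 3 - a * \<beta>\<^sup>2 + b * \<beta> - 1 = 0"
  shows "inverse \<beta> ^ 3 = 1 - a * inverse \<beta> + b * (inverse \<beta>)\<^sup>2"
    and "a - \<beta> = b * inverse \<beta> - (inverse \<beta>)\<^sup>2"
proof -
  have "\<beta> ^ 3 = a * \<beta>\<^sup>2 - b * \<beta> + 1" using assms(2) by simp
  then have 1: "\<beta> * \<beta> * \<beta> = a * \<beta> * \<beta> - b * \<beta> + 1"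
    by (simp add: power2_eq_square power3_eq_cube mult.assoc)
  then show "inverse \<beta> ^ 3 = 1 - a * inverse \<beta> + b * (inverse \<beta>)\<^sup>2"
    using assms(1) by (simp add: field_simps power2_eq_square power3_eq_cube)
  show "a - \<beta> = b * inverse \<beta> - (inverse \<beta>)\<^sup>2"
    using assms(1) 1 by (simp add: field_simps power2_eq_square power3_eq_cube)
qed

text \<open>From \<open>\<beta> * ?u = 1\<close>, \<open>\<beta> * ?s = b - ?u\<close> and
  \<open>\<beta> = a - ?s\<close>, multiplying \<open>m * ?u + n * ?s + k\<close> by
  \<open>- \<beta>\<close> gives \<open>n * ?u + k * ?s\<close> up to an integer, and the interval
  fixes that integer.\<close>

lemma neg_beta_map_srs_value:
  fixes \<beta> :: real and a b :: int
  assumes "\<beta> > 1" "\<beta> ^ 3 - of_int a * \<beta>\<^sup>2 + of_int b * \<beta> - 1 = 0"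
  shows "neg_beta_map \<beta> (srs_value (inverse \<beta>) (of_int a - \<beta>) (- ell \<beta>) z) =
    srs_value (inverse \<beta>) (of_int a - \<beta>) (- ell \<beta>) (srs (inverse \<beta>) (of_int a - \<beta>) (- ell \<beta>) z)"
proof -
  let ?u = "inverse \<beta>" and ?s = "of_int a - \<beta>" and ?\<delta> = "- ell \<beta>"
  obtain m n where z: "z = (m, n)" by (metis surj_pair)
  define k where "k = - \<lfloor>of_int m * ?u + of_int n * ?s + ?\<delta>\<rfloor>"
  define k' where "k' = - \<lfloor>of_int n * ?u + of_int k * ?s + ?\<delta>\<rfloor>"
  have bu: "\<beta> * ?u = 1" using assms(1) by simp
  have "?s = of_int b * ?u - ?u * ?u"
    using inverse_cubic(2)[of \<beta> "of_int a" "of_int b"] assms by (simp add: power2_eq_square)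
  then have "\<beta> * ?s = of_int b * (\<beta> * ?u) - (\<beta> * ?u) * ?u"
    by (metis mult.assoc mult.left_commute right_diff_distrib)
  then have bs: "\<beta> * ?s = of_int b - ?u"
    unfolding bu by simp
  have 1: "srs_value ?u ?s ?\<delta> z = of_int m * ?u + of_int n * ?s + of_int k"
    by (simp add: srs_value_def z k_def)
  have step: "srs ?u ?s ?\<delta> z = (n, k)"
    by (simp add: srs_def z k_def)
  have 2: "srs_value ?u ?s ?\<delta> (srs ?u ?s ?\<delta> z) = of_int n * ?u + of_int k * ?s + of_int k'"
    by (simp add: step srs_value_def k'_def)
  have "- \<beta> * srs_value ?u ?s ?\<delta> z =
      - of_int m * (\<beta> * ?u) - of_int n * (\<beta> * ?s) - of_int k * \<beta>"
    by (simp add: 1 algebra_simps)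
  also have "\<dots> = - of_int m - of_int n * (of_int b - ?u) - of_int k * (of_int a - ?s)"
    unfolding bu bs by simp
  finally have 3: "- \<beta> * srs_value ?u ?s ?\<delta> z - srs_value ?u ?s ?\<delta> (srs ?u ?s ?\<delta> z) =
      of_int (- m - n * b - k * a - k')"
    unfolding 2 by (simp add: algebra_simps)
  show ?thesis
  proof (rule neg_beta_map_eqI[OF 3])
    show "ell \<beta> \<le> srs_value ?u ?s ?\<delta> (srs ?u ?s ?\<delta> z)"
      "srs_value ?u ?s ?\<delta> (srs ?u ?s ?\<delta> z) < ell \<beta> + 1"
      unfolding 2 k'_def by linarith+
  qed
qed

lemma int_adjoin_inverse_cubic:
  fixes \<beta> :: real and a b :: int
  assumes "\<beta> > 1" "\<beta> ^ 3 - of_int a * \<beta>\<^sup>2 + of_int b * \<beta> - 1 = 0"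
    and "x \<in> int_adjoin (inverse \<beta>)"
  shows "\<exists>i j l :: int. x / (- \<beta>) ^ k = of_int i + of_int j * inverse \<beta> + of_int l * (inverse \<beta>)\<^sup>2"
proof -
  define u where "u = inverse \<beta>"
  define M where "M = {of_int i + of_int j * u + of_int l * u\<^sup>2 | i j l :: int. True}"
  have u3: "u ^ 3 = 1 - of_int a * u + of_int b * u\<^sup>2"
    using inverse_cubic(1)[of \<beta> "of_int a" "of_int b"] assms(1,2) by (simp add: u_def)
  \<comment> \<open>This closure property serves twice: \<open>d = 1\<close> is a Horner step, and
    \<open>e = 0\<close>, \<open>d = -1\<close> is a division by \<open>- \<beta>\<close>.\<close>
  have mult: "of_int e + of_int d * u * y \<in> M" if y_in: "y \<in> M" for y and e d :: int
  proof -
    obtain i j l :: int where y: "y = of_int i + of_int j * u + of_int l * u\<^sup>2"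
      using y_in unfolding M_def by blast
    have "u * y = of_int i * u + of_int j * u\<^sup>2 + of_int l * u ^ 3"
      by (simp add: y algebra_simps power2_eq_square power3_eq_cube)
    then have uy: "u * y = of_int l + of_int (i - l * a) * u + of_int (j + l * b) * u\<^sup>2"
      by (simp add: u3 algebra_simps)
    have "of_int e + of_int d * u * y = of_int e + of_int d * (u * y)"
      by simp
    also have "\<dots> = of_int (e + d * l) + of_int (d * (i - l * a)) * u + of_int (d * (j + l * b)) * u\<^sup>2"
      unfolding uy by (simp add: algebra_simps)
    finally show ?thesis unfolding M_def by blast
  qed
  have M0: "0 \<in> M"
    unfolding M_def by (auto intro!: exI[of _ 0])
  obtain p :: "int poly" where "x = poly (map_poly of_int p) u"
    using assms(3) unfolding int_adjoin_def u_def by blast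
  moreover have "poly (map_poly of_int p) u \<in> M" for p :: "int poly"
  proof (induction p)
    case 0
    then show ?case using M0 by simp
  next
    case (pCons e p)
    then show ?case using mult[of _ e 1] by (simp add: map_poly_pCons)
  qed
  ultimately have "x \<in> M" by simp
  have "x / (- \<beta>) ^ k \<in> M"
  proof (induction k)
    case 0
    then show ?case using \<open>x \<in> M\<close> by simp
  next
    case (Suc k)
    have "x / (- \<beta>) ^ Suc k = - u * (x / (- \<beta>) ^ k)"
      by (simp add: u_def field_simps)
    then show ?case using mult[OF Suc, of 0 "-1"] by simp
  qed
  then show ?thesis unfolding M_def u_def by blast
qed

lemma property_neg_F_if_srs_finite:
  fixes \<beta> :: real and a b :: int
  assumes "\<beta> > 1" "\<beta> ^ 3 - of_int a * \<beta>\<^sup>2 + of_int b * \<beta> - 1 = 0"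
    and fin: "\<And>z. srs_finite (inverse \<beta>) (of_int a - \<beta>) (- ell \<beta>) z"
  shows "property_neg_F \<beta>"
proof -
  let ?u = "inverse \<beta>" and ?s = "of_int a - \<beta>" and ?\<delta> = "- ell \<beta>"
  have s: "?s = of_int b * ?u - ?u\<^sup>2"
    using inverse_cubic(2)[of \<beta> "of_int a" "of_int b"] assms(1,2) by simp
  have "\<exists>n. (neg_beta_map \<beta> ^^ n) (x / (- \<beta>) ^ neg_beta_shift \<beta> x) = 0"
    if x: "x \<in> int_adjoin ?u" for x
  proof -
    define y where "y = x / (- \<beta>) ^ neg_beta_shift \<beta> x"
    have I: "ell \<beta> < y" "y < ell \<beta> + 1"
      using neg_beta_shift[OF assms(1)] by (auto simp: y_def)
    obtain i j l :: int where "y = of_int i + of_int j * ?u + of_int l * ?u\<^sup>2"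
      using int_adjoin_inverse_cubic[OF assms(1,2) x] unfolding y_def by blast
    \<comment> \<open>The relation \<open>?u\<^sup>2 = b * ?u - ?s\<close> trades
      \<open>?u\<^sup>2\<close> for \<open>?s\<close>; the integer \<open>i\<close> is then forced
      by the position of \<open>y\<close> in the interval.\<close>
    then have y: "y = of_int (j + l * b) * ?u + of_int (- l) * ?s + of_int i"
      by (simp add: s algebra_simps)
    then have "\<lfloor>of_int (j + l * b) * ?u + of_int (- l) * ?s + ?\<delta>\<rfloor> = - i"
      using I by (intro floor_unique) simp_all
    then have val: "y = srs_value ?u ?s ?\<delta> (j + l * b, - l)"
      using y by (simp add: srs_value_def)
    have orbit: "(neg_beta_map \<beta> ^^ n) (srs_value ?u ?s ?\<delta> z) = srs_value ?u ?s ?\<delta> ((srs ?u ?s ?\<delta> ^^ n) z)"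
      for n z
      by (induction n) (simp_all add: neg_beta_map_srs_value[OF assms(1,2)])
    obtain n where "(srs ?u ?s ?\<delta> ^^ n) (j + l * b, - l) = (0, 0)"
      using fin unfolding srs_finite_def by blast
    moreover have "\<lfloor>?\<delta>\<rfloor> = 0"
      using ell_bounds[OF assms(1)] by (intro floor_unique) auto
    ultimately have "(neg_beta_map \<beta> ^^ n) y = 0"
      unfolding val orbit by (simp add: srs_value_def)
    then show ?thesis unfolding y_def by blast
  qed
  then show ?thesis
    unfolding property_neg_F_def by (simp add: finite_neg_beta_expansion_iff[OF assms(1)])
qed

lemma property_neg_F_sufficient:
  fixes \<beta> :: real and a b :: int
  assumes "\<beta> > 1" "\<beta> ^ 3 - of_int a * \<beta>\<^sup>2 + of_int b * \<beta> - 1 = 0"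
    and "- 1 \<le> b" "b < a" "\<bar>a\<bar> + \<bar>b\<bar> \<ge> 2"
  shows "property_neg_F \<beta>"
proof (rule property_neg_F_if_srs_finite[OF assms(1,2)])
  fix z
  define u where "u = inverse \<beta>"
  have u: "0 < u" "u < 1"
    using assms(1) by (simp_all add: u_def inverse_less_1_iff)
  have u3: "u * u * u = 1 - of_int a * u + of_int b * (u * u)"
    using inverse_cubic(1)[of \<beta> "of_int a" "of_int b"] assms(1,2)
    by (simp add: u_def power2_eq_square power3_eq_cube)
  have s: "of_int a - \<beta> = of_int b * u - u\<^sup>2"
    using inverse_cubic(2)[of \<beta> "of_int a" "of_int b"] assms(1,2) by (simp add: u_def)
  have \<delta>: "- ell \<beta> = 1 / (1 + u)"
    using assms(1) by (simp add: ell_def u_def field_simps)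
  have u3_pos: "0 < u * u * u" using u by simp
  have au: "of_int k * u \<le> of_int a * u" if "k \<le> a" for k
    using that u(1) by simp
  consider "b = -1" "a \<ge> 1" | "b = 0" "a \<ge> 2" | "b = 1" "a \<ge> 2" | "b \<ge> 2" "a \<ge> b + 1"
    using assms(3-5) by linarith
  then have "srs_finite u (of_int b * u - u\<^sup>2) (1 / (1 + u)) z"
  proof cases
    case 1
    have "u\<^sup>2 + u < 1"
      using u3 u3_pos au[of 1] 1 by (simp add: power2_eq_square)
    then show ?thesis using srs_finite_neg_coeff[of u "- u - u\<^sup>2"] u 1 by simp
  next
    case 2
    have "2 * u < 1" using u3 u3_pos au[of 2] 2 by simp
    then have "(2 * u) * u < 1 * u" using u(1) by (rule mult_strict_right_mono)
    then have uu: "2 * (u * u) < u" by simp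
    have "u\<^sup>2 + u < 1" unfolding power2_eq_square using uu \<open>2 * u < 1\<close> by linarith
    moreover have "(u + u\<^sup>2) * (1 + u) \<le> 1"
      using u3 au[of 2] uu 2 by (simp add: power2_eq_square algebra_simps)
    ultimately show ?thesis using srs_finite_zero_coeff[of u "- u\<^sup>2"] u 2 by simp
  next
    case 3
    \<comment> \<open>If this failed, the cubic relation would give
      \<open>(2 * u - 1) * (1 - u) \<le> 0\<close>, hence \<open>u \<le> 1/2\<close>, where
      \<open>u\<^sup>2 + u\<close> is at most 3/4.\<close>
    have "u\<^sup>2 + u < 1"
    proof (rule ccontr)
      assume "\<not> u\<^sup>2 + u < 1"
      then have ge: "u * u + u \<ge> 1" by (simp add: power2_eq_square)
      then have "u * (u * u + u) \<ge> u * 1" using u(1) by (intro mult_left_mono) auto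
      then have "3 * u - 2 * (u * u) - 1 \<le> 0"
        using u3 au[of 2] 3 by (simp add: algebra_simps)
      then have "(2 * u - 1) * (1 - u) \<le> 0" by (simp add: algebra_simps)
      then have "2 * u \<le> 1" using u by (simp add: mult_le_0_iff)
      then have "u * (2 * u) \<le> u * 1" using u(1) by (intro mult_left_mono) auto
      then show False using ge \<open>2 * u \<le> 1\<close> by simp
    qed
    then show ?thesis using srs_finite_one_coeff[of u "u - u\<^sup>2"] u 3 by simp
  next
    case 4
    have ba: "real_of_int b \<le> of_int a - 1" using 4 by linarith
    \<comment> \<open>By \<open>u3\<close> and \<open>b \<le> a - 1\<close>, the positive number
      \<open>u * u * u\<close> is at most \<open>(1 - u) * (1 - (a - 1) * u)\<close>.\<close>
    have lt: "(of_int a - 1) * u < 1"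
    proof (rule ccontr)
      assume "\<not> (of_int a - 1) * u < 1"
      then have "0 \<le> (1 - u) * ((of_int a - 1) * u - 1)"
        using u by (intro mult_nonneg_nonneg) auto
      then have "1 - of_int a * u + (of_int a - 1) * (u * u) \<le> 0"
        by (simp add: algebra_simps)
      moreover have "of_int b * (u * u) \<le> (of_int a - 1) * (u * u)"
        using ba by (intro mult_right_mono) auto
      ultimately show False using u3 u3_pos by linarith
    qed
    have "of_int b * u \<le> (of_int a - 1) * u"
      using ba u by (intro mult_right_mono) auto
    moreover have "2 * u \<le> of_int b * u"
      using 4 u by (intro mult_right_mono) auto
    ultimately have bu: "of_int b * u < 1" "2 * u \<le> of_int b * u" "2 * u < 1"
      using lt by linarith+
    have uu: "0 < u * u" "2 * (u * u) < u"
      using bu(3) mult_strict_left_mono[OF bu(3) u(1)] u by simp_all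
    have "(of_int b * u - u\<^sup>2) * (1 + u) \<le> 1 \<or> u\<^sup>2 + 2 * u \<le> 1"
    proof (cases "a \<ge> 4")
      case True
      have "3 * u \<le> (of_int a - 1) * u"
        using True u by (intro mult_right_mono) auto
      then have "u\<^sup>2 + 2 * u \<le> 1"
        unfolding power2_eq_square using lt uu by linarith
      then show ?thesis by blast
    next
      case False
      then have ab: "a = 3" "b = 2" using 4 by auto
      have cubic: "u * u * u = 1 - 3 * u + 2 * (u * u)" using u3 ab by simp
      \<comment> \<open>Modulo the cubic the goal becomes \<open>5 * u \<le> u * u + 2\<close>. The
        bound 7/16 lies between \<open>u\<close>, about 0.430, and the smaller root of
        \<open>x * x - 5 * x + 2\<close>, about 0.438.\<close>
      have "16 * u \<le> 7"
      proof (rule ccontr)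
        assume "\<not> 16 * u \<le> 7"
        \<comment> \<open>This is the difference quotient of
          \<open>x ^ 3 - 2 * x\<^sup>2 + 3 * x\<close> between \<open>u\<close> and 7/16.\<close>
        moreover have "0 < u * u + u * (7/16) + 49/256 - 2 * u - 7/8 + 3"
          using bu(3) uu u by linarith
        ultimately have "0 < (u - 7/16) * (u * u + u * (7/16) + 49/256 - 2 * u - 7/8 + 3)"
          by simp
        also have "\<dots> = u * u * u - 2 * (u * u) + 3 * u - (343/4096 - 98/256 + 21/16)"
          by (simp add: field_simps)
        finally show False using cubic by simp
      qed
      then have "0 \<le> (7/16 - u) * (73/16 - u)" using bu by simp
      also have "\<dots> = u * u - 5 * u + 511/256"
        by (simp add: field_simps)
      finally have "5 * u \<le> u * u + 2" by simp
      moreover have "(of_int b * u - u\<^sup>2) * (1 + u) = 2 * u + u * u - u * u * u"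
        using ab by (simp add: algebra_simps power2_eq_square)
      ultimately have "(of_int b * u - u\<^sup>2) * (1 + u) \<le> 1"
        using cubic by linarith
      then show ?thesis by blast
    qed
    then show ?thesis
      using srs_finite_pos_coeff[of u "of_int b * u - u\<^sup>2"] u bu uu by (simp add: power2_eq_square)
  qed
  then show "srs_finite (inverse \<beta>) (of_int a - \<beta>) (- ell \<beta>) z"
    unfolding s \<delta> by (simp add: u_def)
qed

section \<open>Necessity\<close>

lemma min_poly_root_small_degree:
  fixes x :: "'a :: field_char_0"
  assumes "is_min_poly x p" "poly (map_poly of_rat q) x = 0" "degree q < degree p"
  shows "q = 0"
proof (rule ccontr)
  assume "q \<noteq> 0"
  let ?l = "lead_coeff q"
  have "map_poly of_rat (smult (inverse ?l) q) = smult (of_rat (inverse ?l)) (map_poly of_rat q :: 'a poly)"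
    by (rule map_poly_smult) (simp_all add: of_rat_mult)
  then have "poly (map_poly of_rat (smult (inverse ?l) q)) x = 0"
    using assms(2) by simp
  moreover have "lead_coeff (smult (inverse ?l) q) = 1"
    using \<open>q \<noteq> 0\<close> by simp
  ultimately have "degree p \<le> degree (smult (inverse ?l) q)"
    using assms(1) unfolding is_min_poly_def by blast
  then show False using assms(3) by (metis degree_smult_le leD le_trans)
qed

text \<open>Division with remainder stays integral because the divisor is monic. In a Horner step
  the remainder is multiplied by \<open>x\<close>, and its new cubic term passes \<open>r2\<close>
  to the quotient.\<close>

lemma poly_eq_mult_cubic_plus:
  fixes a b c :: int and Q :: "int poly"
  shows "\<exists>S :: int poly. \<exists>r0 r1 r2 :: int. \<forall>x :: real. poly (map_poly of_int Q) x =
    (x ^ 3 - of_int a * x\<^sup>2 + of_int b * x - of_int c) * poly (map_poly of_int S) x +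
    of_int r0 + of_int r1 * x + of_int r2 * x\<^sup>2"
proof (induction Q)
  case 0
  show ?case by (rule exI[of _ 0])+ simp
next
  case (pCons q Q)
  then obtain S :: "int poly" and r0 r1 r2 :: int where IH: "\<And>x :: real. poly (map_poly of_int Q) x =
    (x ^ 3 - of_int a * x\<^sup>2 + of_int b * x - of_int c) * poly (map_poly of_int S) x +
    of_int r0 + of_int r1 * x + of_int r2 * x\<^sup>2"
    by blast
  have "poly (map_poly of_int (pCons q Q)) x =
    (x ^ 3 - of_int a * x\<^sup>2 + of_int b * x - of_int c) * poly (map_poly of_int (pCons r2 S)) x +
    of_int (q + r2 * c) + of_int (r0 - b * r2) * x + of_int (r1 + a * r2) * x\<^sup>2" for x :: real
    by (simp add: map_poly_pCons IH algebra_simps power2_eq_square power3_eq_cube)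
  then show ?case by blast
qed

lemma cubic_min_poly_indep:
  fixes \<beta> :: real and a b c r0 r1 r2 :: int
  assumes "is_min_poly \<beta> [:- of_int c, of_int b, - of_int a, 1:]"
    and "of_int r0 + of_int r1 * \<beta> + of_int r2 * \<beta>\<^sup>2 = 0"
  shows "r0 = 0 \<and> r1 = 0 \<and> r2 = 0"
proof -
  have "[:of_int r0, of_int r1, of_int r2:] = (0 :: rat poly)"
    by (rule min_poly_root_small_degree[OF assms(1)])
      (use assms(2) in \<open>simp_all add: map_poly_pCons algebra_simps power2_eq_square degree_pCons_eq_if\<close>)
  then show ?thesis by simp
qed

lemma cubic_min_poly_root:
  fixes \<beta> :: real and a b c :: int
  assumes "is_min_poly \<beta> [:- of_int c, of_int b, - of_int a, 1:]"
  shows "\<beta> ^ 3 - of_int a * \<beta>\<^sup>2 + of_int b * \<beta> - of_int c = 0"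
  using assms unfolding is_min_poly_def
  by (simp add: map_poly_pCons of_rat_minus algebra_simps power2_eq_square power3_eq_cube)

lemma cubic_min_poly_dvd:
  fixes \<beta> :: real and a b c :: int
  assumes min: "is_min_poly \<beta> [:- of_int c, of_int b, - of_int a, 1:]"
    and "poly (map_poly of_int Q) \<beta> = 0"
  shows "\<exists>S :: int poly. \<forall>x :: real. poly (map_poly of_int Q) x =
    (x ^ 3 - of_int a * x\<^sup>2 + of_int b * x - of_int c) * poly (map_poly of_int S) x"
proof -
  obtain S :: "int poly" and r0 r1 r2 :: int where S: "\<And>x :: real. poly (map_poly of_int Q) x =
    (x ^ 3 - of_int a * x\<^sup>2 + of_int b * x - of_int c) * poly (map_poly of_int S) x +
    of_int r0 + of_int r1 * x + of_int r2 * x\<^sup>2"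
    using poly_eq_mult_cubic_plus[of Q a b c] by blast
  have "of_int r0 + of_int r1 * \<beta> + of_int r2 * \<beta>\<^sup>2 = 0"
    using S[of \<beta>] cubic_min_poly_root[OF min] assms(2) by simp
  then have "r0 = 0 \<and> r1 = 0 \<and> r2 = 0"
    by (rule cubic_min_poly_indep[OF min])
  then show ?thesis using S by auto
qed

text \<open>Reversing a monic integer polynomial that vanishes at \<open>inverse \<beta>\<close>
  gives one that vanishes at \<open>\<beta>\<close> and has constant coefficient 1. It is a multiple
  of the minimal polynomial, so \<open>c\<close> divides 1.\<close>

lemma algebraic_unit_norm:
  fixes \<beta> :: real and a b c :: int
  assumes min: "is_min_poly \<beta> [:- of_int c, of_int b, - of_int a, 1:]"
    and unit: "algebraic_unit \<beta>"
  shows "\<bar>c\<bar> = 1"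
proof -
  obtain P :: "int poly" where P: "poly (map_poly of_int P) (inverse \<beta>) = 0" "lead_coeff P = 1"
    using unit unfolding algebraic_unit_def algebraic_int_altdef_ipoly by blast
  have refl: "map_poly of_int (reflect_poly P) = reflect_poly (map_poly of_int P :: real poly)"
    by (rule poly_eqI) (simp add: coeff_map_poly coeff_reflect_poly degree_map_poly)
  have "poly (map_poly of_int (reflect_poly P)) \<beta> = 0"
    using unit P(1) unfolding refl by (simp add: poly_reflect_poly_nz algebraic_unit_def)
  then obtain S :: "int poly" where "\<And>x :: real. poly (map_poly of_int (reflect_poly P)) x =
      (x ^ 3 - of_int a * x\<^sup>2 + of_int b * x - of_int c) * poly (map_poly of_int S) x"
    using cubic_min_poly_dvd[OF min] by blast
  from this[of 0] have "real_of_int 1 = of_int (- c * coeff S 0)"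
    using P(2) by (simp add: poly_0_coeff_0 coeff_map_poly)
  then have "1 = - c * coeff S 0"
    by (simp only: of_int_eq_iff)
  then show ?thesis
    by (metis abs_minus_cancel dvd_triv_left zdvd1_eq)
qed

section \<open>Real conjugates and the sign of the minimal polynomial at 1 and -1\<close>

lemma pisot_conjugate:
  fixes \<beta> t :: real and a b c :: int
  assumes "is_min_poly \<beta> [:- of_int c, of_int b, - of_int a, 1:]" "pisot_number \<beta>"
    and "t ^ 3 - of_int a * t\<^sup>2 + of_int b * t - of_int c = 0" "t \<noteq> \<beta>"
  shows "\<bar>t\<bar> < 1"
proof -
  have "poly (map_poly of_rat [:- of_int c, of_int b, - of_int a, 1:]) (complex_of_real t) =
      of_real (t ^ 3 - of_int a * t\<^sup>2 + of_int b * t - of_int c)"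
    by (simp add: map_poly_pCons of_rat_minus algebra_simps power2_eq_square power3_eq_cube)
  also have "\<dots> = 0" unfolding assms(3) by simp
  finally have "complex_of_real t \<in> galois_conjugates \<beta> - {complex_of_real \<beta>}"
    using assms(1,4) unfolding galois_conjugates_def
    by (intro DiffI CollectI exI[of _ "[:- of_int c, of_int b, - of_int a, 1:]"]) auto
  then have "norm (complex_of_real t) < 1"
    using assms(2) unfolding pisot_number_def by blast
  then show ?thesis by simp
qed

lemma monic_quadratic_roots:
  fixes B C x :: real
  assumes "x\<^sup>2 + B * x + C \<le> 0"
  shows "\<exists>t \<le> x. t\<^sup>2 + B * t + C = 0" and "\<exists>t \<ge> x. t\<^sup>2 + B * t + C = 0"
proof -
  define R where "R = sqrt (B\<^sup>2 - 4 * C)"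
  have D: "(2 * x + B)\<^sup>2 \<le> B\<^sup>2 - 4 * C"
    using assms by (simp add: power2_eq_square algebra_simps)
  then have RR: "R * R = B * B - 4 * C"
    unfolding R_def using order_trans[OF zero_le_power2 D] by (simp add: power2_eq_square)
  have "\<bar>2 * x + B\<bar> \<le> R"
    unfolding R_def using D real_le_rsqrt by (metis power2_abs)
  then have "(- B - R) / 2 \<le> x \<and> x \<le> (- B + R) / 2"
    by (simp add: abs_le_iff)
  moreover have "((- B - R) / 2)\<^sup>2 + B * ((- B - R) / 2) + C = 0"
      "((- B + R) / 2)\<^sup>2 + B * ((- B + R) / 2) + C = 0"
    using RR by (simp_all add: power2_eq_square field_simps)
  ultimately show "\<exists>t \<le> x. t\<^sup>2 + B * t + C = 0" "\<exists>t \<ge> x. t\<^sup>2 + B * t + C = 0"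
    by blast+
qed

lemma cubic_cofactor:
  fixes \<beta> a b c t :: real
  assumes "\<beta> ^ 3 - a * \<beta>\<^sup>2 + b * \<beta> - c = 0"
  shows "t ^ 3 - a * t\<^sup>2 + b * t - c =
    (t - \<beta>) * (t\<^sup>2 + (\<beta> - a) * t + (\<beta>\<^sup>2 - a * \<beta> + b))"
proof -
  have "c = \<beta> ^ 3 - a * \<beta>\<^sup>2 + b * \<beta>" using assms by simp
  then show ?thesis by (simp add: algebra_simps power2_eq_square power3_eq_cube)
qed

text \<open>A nonnegative value of the cubic at 1 would make its cofactor of
  \<open>x - \<beta>\<close> nonpositive there, giving a root \<open>t \<ge> 1\<close>. The Pisot
  property leaves only a double root \<open>\<beta>\<close>.\<close>

lemma pisot_cubic_at_one:
  fixes \<beta> :: real and a b c :: int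
  assumes min: "is_min_poly \<beta> [:- of_int c, of_int b, - of_int a, 1:]" and pisot: "pisot_number \<beta>"
  shows "1 - a + b - c < 0"
proof (rule ccontr)
  assume *: "\<not> 1 - a + b - c < 0"
  have root: "\<beta> ^ 3 - of_int a * \<beta>\<^sup>2 + of_int b * \<beta> - of_int c = 0"
    using cubic_min_poly_root[OF min] .
  let ?q = "\<lambda>t :: real. t\<^sup>2 + (\<beta> - of_int a) * t + (\<beta>\<^sup>2 - of_int a * \<beta> + of_int b)"
  have "\<beta> > 1" using pisot by (simp add: pisot_number_def)
  have "0 \<le> real_of_int (1 - a + b - c)" using * by simp
  then have "0 \<le> (1 - \<beta>) * ?q 1"
    using cubic_cofactor[OF root, of 1] by simp
  then have "?q 1 \<le> 0"
    using \<open>\<beta> > 1\<close> by (simp add: zero_le_mult_iff)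
  from monic_quadratic_roots(2)[OF this] obtain t where t: "t \<ge> 1" "?q t = 0" by blast
  then have "t ^ 3 - of_int a * t\<^sup>2 + of_int b * t - of_int c = 0"
    using cubic_cofactor[OF root, of t] by simp
  then have "t = \<beta>"
    using pisot_conjugate[OF min pisot, of t] t(1) by fastforce
  \<comment> \<open>The cofactor at \<open>\<beta>\<close> is the derivative of the cubic at
    \<open>\<beta>\<close>.\<close>
  then have "of_int b + of_int (- 2 * a) * \<beta> + of_int 3 * \<beta>\<^sup>2 = 0"
    using t(2) by (simp add: algebra_simps power2_eq_square)
  then show False
    using cubic_min_poly_indep[OF min] by fastforce
qed

text \<open>The same argument at -1, except that a root \<open>t \<le> - 1\<close> cannot be
  \<open>\<beta>\<close>.\<close>

lemma pisot_cubic_at_minus_one: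
  fixes \<beta> :: real and a b c :: int
  assumes min: "is_min_poly \<beta> [:- of_int c, of_int b, - of_int a, 1:]" and pisot: "pisot_number \<beta>"
  shows "1 + a + b + c > 0"
proof (rule ccontr)
  assume *: "\<not> 1 + a + b + c > 0"
  have root: "\<beta> ^ 3 - of_int a * \<beta>\<^sup>2 + of_int b * \<beta> - of_int c = 0"
    using cubic_min_poly_root[OF min] .
  let ?q = "\<lambda>t :: real. t\<^sup>2 + (\<beta> - of_int a) * t + (\<beta>\<^sup>2 - of_int a * \<beta> + of_int b)"
  have "\<beta> > 1" using pisot by (simp add: pisot_number_def)
  have "0 \<le> real_of_int (- (1 + a + b + c))" using * by (simp only: of_int_0_le_iff)
  then have "0 \<le> (- 1 - \<beta>) * ?q (- 1)"
    using cubic_cofactor[OF root, of "- 1"] by simp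
  then have "?q (- 1) \<le> 0"
    using \<open>\<beta> > 1\<close> by (simp add: zero_le_mult_iff)
  from monic_quadratic_roots(1)[OF this] obtain t where t: "t \<le> - 1" "?q t = 0" by blast
  then have "t ^ 3 - of_int a * t\<^sup>2 + of_int b * t - of_int c = 0"
    using cubic_cofactor[OF root, of t] by simp
  then show False
    using pisot_conjugate[OF min pisot, of t] t(1) \<open>\<beta> > 1\<close> by fastforce
qed

text \<open>The cofactor of \<open>x - \<beta>\<close> has the negative value
  \<open>c / \<beta>\<close> at 0.\<close>

lemma cubic_negative_root:
  fixes \<beta> a b c :: real
  assumes "\<beta> > 0" "\<beta> ^ 3 - a * \<beta>\<^sup>2 + b * \<beta> - c = 0" "c < 0"
  shows "\<exists>t < 0. t ^ 3 - a * t\<^sup>2 + b * t - c = 0"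
proof -
  let ?C = "\<beta>\<^sup>2 - a * \<beta> + b"
  have "\<beta> * ?C = c"
    using assms(2) by (simp add: algebra_simps power2_eq_square power3_eq_cube)
  then have C: "?C < 0"
    using assms(1,3) by (metis mult_less_0_iff not_less_iff_gr_or_eq)
  then have "0\<^sup>2 + (\<beta> - a) * 0 + ?C \<le> 0" by simp
  from monic_quadratic_roots(1)[OF this] obtain t
    where t: "t \<le> 0" "t\<^sup>2 + (\<beta> - a) * t + ?C = 0" by blast
  then have "t \<noteq> 0" using C by auto
  then show ?thesis
    using t cubic_cofactor[OF assms(2), of t] by (intro exI[of _ t]) auto
qed

text \<open>Along a finite expansion, \<open>x\<close> is a combination of powers of \<open>-\<beta>\<close> with nonnegative coefficients;
  a negative conjugate \<open>t\<close> turns these into nonnegative powers of \<open>-t\<close>, which rules out \<open>x = -1\<close>.\<close>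

lemma not_property_neg_F_if_negative_conjugate:
  fixes \<beta> t :: real
  assumes "\<beta> > 1" "t < 0"
    and conj: "\<And>Q :: int poly. poly (map_poly of_int Q) \<beta> = 0 \<Longrightarrow> poly (map_poly of_int Q) t = 0"
  shows "\<not> property_neg_F \<beta>"
proof
  assume F: "property_neg_F \<beta>"
  define k where "k = neg_beta_shift \<beta> (- 1)"
  define y where "y = - 1 / (- \<beta>) ^ k"
  have "- 1 \<in> int_adjoin (inverse \<beta>)"
    unfolding int_adjoin_def by (rule range_eqI[of _ _ "[:- 1:]"]) (simp add: map_poly_pCons)
  then obtain n where n: "(neg_beta_map \<beta> ^^ n) y = 0"
    using F by (auto simp: property_neg_F_def finite_neg_beta_expansion_iff[OF assms(1)] y_def k_def)
  have y: "ell \<beta> \<le> y" "y < ell \<beta> + 1"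
    using neg_beta_shift[OF assms(1), of "- 1"] by (auto simp: y_def k_def)
  \<comment> \<open>\<open>D\<close> collects the digits read so far. A step with digit
    \<open>d\<close> replaces it by \<open>d - X * D\<close>, which keeps the value at the negative
    \<open>t\<close> nonnegative.\<close>
  have orbit: "\<exists>D :: int poly. (neg_beta_map \<beta> ^^ i) y = (- \<beta>) ^ i * y - poly (map_poly of_int D) \<beta> \<and>
      0 \<le> poly (map_poly of_int D) t" for i
  proof (induction i)
    case 0
    show ?case by (rule exI[of _ 0]) simp
  next
    case (Suc i)
    then obtain D :: "int poly" where
      D: "(neg_beta_map \<beta> ^^ i) y = (- \<beta>) ^ i * y - poly (map_poly of_int D) \<beta>"
        "0 \<le> poly (map_poly of_int D) t" by blast
    define d where "d = neg_beta_digit \<beta> y i"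
    have "(neg_beta_map \<beta> ^^ i) y < ell \<beta> + 1"
      using y neg_beta_map_range[of \<beta>] by (cases i) auto
    then have "\<beta> * (neg_beta_map \<beta> ^^ i) y < \<beta> * (1 / (\<beta> + 1))"
      using assms(1) by (simp only: ell_add_one mult_strict_left_mono)
    then have "0 \<le> d"
      using assms(1) by (simp add: d_def neg_beta_digit_def ell_def)
    have minus: "map_poly of_int (- D) = - (map_poly of_int D :: real poly)"
      by (rule poly_eqI) (simp add: coeff_map_poly)
    have "t * poly (map_poly of_int D) t \<le> 0"
      using D(2) assms(2) by (intro mult_nonpos_nonneg) auto
    then have "t * poly (map_poly of_int D) t \<le> of_int d"
      using \<open>0 \<le> d\<close> by (meson of_int_0_le_iff order_trans)
    then have "0 \<le> poly (map_poly of_int (pCons d (- D))) t"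
      by (simp add: map_poly_pCons minus)
    moreover have "(neg_beta_map \<beta> ^^ Suc i) y =
        (- \<beta>) ^ Suc i * y - poly (map_poly of_int (pCons d (- D))) \<beta>"
      unfolding neg_beta_map_digit D(1) d_def[symmetric]
      by (simp add: map_poly_pCons minus algebra_simps)
    ultimately show ?case by blast
  qed
  \<comment> \<open>The \<open>k\<close> additional steps clear the denominator
    \<open>(- \<beta>) ^ k\<close> of \<open>y\<close>, leaving an integer polynomial relation for
    \<open>\<beta>\<close>.\<close>
  obtain D :: "int poly" where
    D: "(neg_beta_map \<beta> ^^ (n + k)) y = (- \<beta>) ^ (n + k) * y - poly (map_poly of_int D) \<beta>"
      "0 \<le> poly (map_poly of_int D) t"
    using orbit by blast
  have "(neg_beta_map \<beta> ^^ (n + k)) y = 0"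
    using funpow_fixed_ge[OF n neg_beta_map_0[OF assms(1)]] by simp
  moreover have "(- \<beta>) ^ (n + k) * y = - ((- \<beta>) ^ n)"
    using assms(1) by (simp add: y_def power_add)
  ultimately have D_beta: "poly (map_poly of_int D) \<beta> = - ((- \<beta>) ^ n)"
    using D(1) by simp
  have sum: "poly (map_poly of_int (monom ((- 1) ^ n) n + D)) x = (- x) ^ n + poly (map_poly of_int D) x"
    for x :: real
  proof -
    have "map_poly of_int (monom ((- 1) ^ n) n + D) =
        monom ((- 1) ^ n) n + (map_poly of_int D :: real poly)"
      by (rule poly_eqI) (simp add: coeff_map_poly)
    then show ?thesis
      by (simp add: poly_monom power_mult_distrib[symmetric])
  qed
  have "poly (map_poly of_int (monom ((- 1) ^ n) n + D)) \<beta> = 0"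
    unfolding sum D_beta by simp
  then have "(- t) ^ n + poly (map_poly of_int D) t = 0"
    using conj unfolding sum[symmetric] by blast
  moreover have "(- t) ^ n > 0" using assms(2) by simp
  ultimately show False using D(2) by simp
qed

section \<open>Nonzero periodic points\<close>

lemma not_property_neg_F_fixed_point:
  fixes \<beta> :: real and a b :: int
  assumes "\<beta> > 1" "\<beta> ^ 3 - of_int a * \<beta>\<^sup>2 + of_int b * \<beta> - 1 = 0"
    and d: "0 < a + b + 2" "of_int (a + b + 2) < \<beta>"
  shows "\<not> property_neg_F \<beta>"
proof -
  define u where "u = inverse \<beta>"
  \<comment> \<open>A fixed point with digit \<open>d\<close> is \<open>- d / (\<beta> + 1)\<close>;
    it exceeds \<open>ell \<beta>\<close> exactly when \<open>d < \<beta>\<close>.\<close>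
  define x where "x = - of_int (a + b + 2) / (\<beta> + 1)"
  have u: "u > 0" "\<beta> = 1 / u" using assms(1) by (simp_all add: u_def field_simps)
  have "u ^ 3 = 1 - of_int a * u + of_int b * u\<^sup>2"
    using inverse_cubic(1)[of \<beta> "of_int a" "of_int b"] assms(1,2) by (simp add: u_def)
  \<comment> \<open>The cubic has value \<open>- (a + b + 2)\<close> at -1, so
    \<open>\<beta> + 1\<close> divides \<open>a + b + 2\<close> in the ring; the explicit cofactor
    in \<open>u\<close> shows that \<open>x\<close> belongs to it.\<close>
  then have "(1 + u) * (of_int (a + b + 1) - of_int (b + 1) * u + u\<^sup>2) = of_int (a + b + 2)"
    by (simp add: algebra_simps power2_eq_square power3_eq_cube)
  moreover have "x * (1 + u) = - u * of_int (a + b + 2)"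
  proof -
    have "1 + u = u * (\<beta> + 1)" using assms(1) by (simp add: u_def algebra_simps)
    then have "x * (1 + u) = u * (x * (\<beta> + 1))" by simp
    also have "x * (\<beta> + 1) = - of_int (a + b + 2)" using assms(1) by (simp add: x_def)
    finally show ?thesis by (simp add: algebra_simps)
  qed
  ultimately have "(1 + u) * x = (1 + u) * (- u * (of_int (a + b + 1) - of_int (b + 1) * u + u\<^sup>2))"
    by (metis mult.commute mult.left_commute)
  then have "x = - u * (of_int (a + b + 1) - of_int (b + 1) * u + u\<^sup>2)"
    using u(1) by (subst (asm) mult_left_cancel) auto
  then have "x = poly (map_poly of_int [:0, - (a + b + 1), b + 1, - 1:]) u"
    by (simp add: map_poly_pCons algebra_simps power2_eq_square)
  then have "x \<in> int_adjoin (inverse \<beta>)"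
    unfolding int_adjoin_def u_def by blast
  moreover have I: "x \<in> {ell \<beta> <..< ell \<beta> + 1}"
  proof -
    have "0 < real_of_int (a + b + 2)" using d(1) by linarith
    then have "x < 0" unfolding x_def using assms(1) by (intro divide_neg_pos) auto
    moreover have "ell \<beta> < x"
      unfolding x_def ell_def using d(2) assms(1) by (intro divide_strict_right_mono) auto
    ultimately show ?thesis using ell_bounds[OF assms(1)] by auto
  qed
  moreover have "neg_beta_map \<beta> x = x"
  proof (rule neg_beta_map_eqI)
    have "(\<beta> + 1) * x = - of_int (a + b + 2)"
      using assms(1) by (simp add: x_def)
    then show "- \<beta> * x - x = of_int (a + b + 2)" by (simp add: algebra_simps)
  qed (use I in auto)
  moreover have "x \<noteq> 0"
    using d(1) assms(1) by (simp add: x_def flip: of_int_add)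
  ultimately show ?thesis
    using not_property_neg_F_if_periodic[OF assms(1), of x 1] by simp
qed

lemma not_property_neg_F_cycle:
  assumes "\<beta> > 1" "\<beta> ^ 3 = \<beta>\<^sup>2 + 1"
  shows "\<not> property_neg_F \<beta>"
proof -
  have cube: "\<beta> * \<beta> * \<beta> = \<beta> * \<beta> + 1"
    using assms(2) by (simp add: power2_eq_square power3_eq_cube)
  \<comment> \<open>The function \<open>x * x * (x - 1)\<close> increases from 1 on and is 1 at
    \<open>\<beta>\<close>; its values at 1.46 and 1.47 enclose \<open>\<beta>\<close>.\<close>
  have mono: "s * s * (s - 1) \<le> r * r * (r - 1)" if "1 \<le> s" "s \<le> r" for r s :: real
    using that by (intro mult_mono) auto
  have eq: "\<beta> * \<beta> * (\<beta> - 1) = 1" using cube by (simp add: algebra_simps)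
  have bounds: "1.46 < \<beta>" "\<beta> < 1.47"
    using mono[of \<beta> "1.46"] mono[of "1.47" \<beta>] assms(1) eq by (auto simp: not_less[symmetric])
  define w where "w = \<beta> * \<beta>"
  have wb: "w * \<beta> = w + 1" using cube by (simp add: w_def)
  have w: "2.13 < w" "w < 2.161"
    using mult_strict_mono[OF bounds(1) bounds(1)] mult_strict_mono[OF bounds(2) bounds(2)] bounds
    by (simp_all add: w_def)
  have ell: "ell \<beta> < - 0.59" "- 0.6 < ell \<beta>"
    using bounds by (simp_all add: ell_def field_simps)
  \<comment> \<open>The cycle is written in the basis 1, \<open>\<beta>\<close>, \<open>w\<close>,
    with \<open>1 - 1 / \<beta>\<close> as \<open>1 - w + \<beta>\<close>. Its digits are 0, 1, 1,
    1, 0; the decimal bounds keep all five points in the interval.\<close>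
  note eqI = neg_beta_map_eqI[where \<beta> = \<beta>]
  have "neg_beta_map \<beta> (1 - w + \<beta>) = 1 - \<beta>"
    by (rule eqI[where d = 0]) (use wb w bounds ell in \<open>simp_all add: algebra_simps w_def[symmetric]\<close>)
  moreover have "neg_beta_map \<beta> (1 - \<beta>) = w - \<beta> - 1"
    by (rule eqI[where d = 1]) (use wb w bounds ell in \<open>simp_all add: algebra_simps w_def[symmetric]\<close>)
  moreover have "neg_beta_map \<beta> (w - \<beta> - 1) = \<beta> - 2"
    by (rule eqI[where d = 1]) (use wb w bounds ell in \<open>simp_all add: algebra_simps w_def[symmetric]\<close>)
  moreover have "neg_beta_map \<beta> (\<beta> - 2) = 2 * \<beta> - w - 1"
    by (rule eqI[where d = 1]) (use wb w bounds ell in \<open>simp_all add: algebra_simps w_def[symmetric]\<close>)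
  moreover have "neg_beta_map \<beta> (2 * \<beta> - w - 1) = 1 - w + \<beta>"
    by (rule eqI[where d = 0]) (use wb w bounds ell in \<open>simp_all add: algebra_simps w_def[symmetric]\<close>)
  ultimately have "(neg_beta_map \<beta> ^^ 5) (1 - w + \<beta>) = 1 - w + \<beta>"
    by (simp add: numeral_eq_Suc)
  moreover have "1 - w + \<beta> \<in> int_adjoin (inverse \<beta>)"
  proof -
    have "\<beta> * (1 - w + \<beta>) = \<beta> - 1"
      using wb by (simp add: algebra_simps w_def[symmetric])
    then have "1 - w + \<beta> = 1 - inverse \<beta>"
      using assms(1) by (simp add: field_simps)
    also have "\<dots> = poly (map_poly of_int [:1, - 1:]) (inverse \<beta>)"
      by (simp add: map_poly_pCons)
    finally show ?thesis unfolding int_adjoin_def by blast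
  qed
  moreover have "1 - w + \<beta> \<in> {ell \<beta> <..< ell \<beta> + 1}" "1 - w + \<beta> \<noteq> 0"
    using w bounds ell by auto
  ultimately show ?thesis
    using not_property_neg_F_if_periodic[OF assms(1), of "1 - w + \<beta>" 5] by simp
qed

theorem theorem2:
  fixes \<beta> :: real and a b c :: int
  assumes "cubic_pisot_unit \<beta>"
    and "is_min_poly \<beta> [:- of_int c, of_int b, - of_int a, 1:]"
  shows "property_neg_F \<beta> \<longleftrightarrow> c = 1 \<and> - 1 \<le> b \<and> b < a \<and> \<bar>a\<bar> + \<bar>b\<bar> \<ge> 2"
proof
  note min = assms(2)
  have pisot: "pisot_number \<beta>" and unit: "algebraic_unit \<beta>"
    using assms(1) by (simp_all add: cubic_pisot_unit_def)
  have \<beta>: "\<beta> > 1" using pisot by (simp add: pisot_number_def)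
  note root = cubic_min_poly_root[OF min]
  {
    assume *: "c = 1 \<and> - 1 \<le> b \<and> b < a \<and> \<bar>a\<bar> + \<bar>b\<bar> \<ge> 2"
    then have "\<beta> ^ 3 - of_int a * \<beta>\<^sup>2 + of_int b * \<beta> - 1 = 0"
      using root by simp
    then show "property_neg_F \<beta>"
      using property_neg_F_sufficient[OF \<beta>] * by blast
  }
  assume F: "property_neg_F \<beta>"
  have c: "c = 1"
  proof (rule ccontr)
    assume "c \<noteq> 1"
    then have "real_of_int c < 0" using algebraic_unit_norm[OF min unit] by simp
    then obtain t :: real where t: "t < 0" "t ^ 3 - of_int a * t\<^sup>2 + of_int b * t - of_int c = 0"
      using cubic_negative_root[OF _ root] \<beta> by fastforce
    have "poly (map_poly of_int Q) t = 0" if "poly (map_poly of_int Q) \<beta> = 0" for Q :: "int poly"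
      using cubic_min_poly_dvd[OF min that] t(2) by fastforce
    then show False
      using not_property_neg_F_if_negative_conjugate[OF \<beta> t(1)] F by blast
  qed
  then have root1: "\<beta> ^ 3 - of_int a * \<beta>\<^sup>2 + of_int b * \<beta> - 1 = 0"
    using root by simp
  have ba: "b < a" "a + b + 2 > 0"
    using pisot_cubic_at_one[OF min pisot] pisot_cubic_at_minus_one[OF min pisot] c by simp_all
  have large: "\<not> of_int (a + b + 2) < \<beta>"
    using not_property_neg_F_fixed_point[OF \<beta> root1 ba(2)] F by blast
  \<comment> \<open>For \<open>b \<le> -2\<close> the cubic gives \<open>\<beta> > a\<close>, and
    \<open>a\<close> is at least \<open>a + b + 2\<close>, against \<open>large\<close>.\<close>
  have b: "- 1 \<le> b"
  proof (rule ccontr)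
    assume "\<not> - 1 \<le> b"
    then have "b \<le> - 2" by simp
    then have "of_int b * \<beta> < 0" using \<beta> by (simp add: mult_neg_pos)
    then have "\<beta>\<^sup>2 * (\<beta> - of_int a) > 0"
      using root1 by (simp add: algebra_simps power2_eq_square power3_eq_cube)
    then have "of_int a < \<beta>" by (simp add: zero_less_mult_iff)
    moreover have "real_of_int (a + b + 2) \<le> of_int a" using \<open>b \<le> - 2\<close> by simp
    ultimately show False using large by linarith
  qed
  \<comment> \<open>Otherwise \<open>large\<close> would say \<open>\<beta> \<le> 1\<close>. Given
    \<open>-1 \<le> b < a\<close>, the only pairs with
    \<open>\<bar>a\<bar> + \<bar>b\<bar> < 2\<close> are \<open>(0, -1)\<close>, excluded here, and
    \<open>(1, 0)\<close>, excluded by the cycle.\<close>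
  have "a + b \<noteq> - 1"
    using large \<beta> by auto
  moreover have "\<not> (a = 1 \<and> b = 0)"
    using not_property_neg_F_cycle[OF \<beta>] root1 F by auto
  ultimately have "\<bar>a\<bar> + \<bar>b\<bar> \<ge> 2"
    using ba b by linarith
  then show "c = 1 \<and> - 1 \<le> b \<and> b < a \<and> \<bar>a\<bar> + \<bar>b\<bar> \<ge> 2"
    using ba b c by blast
qed

end
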